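(* Let $X$ be a Banach space and let $T\in B(X)$. If $T$ is distributionally chaotic of type $2\frac12$, then $T$ is reiteratively distributionally chaotic of type $1$ and reiteratively distributionally chaotic of type $2$.
   Context: $B(X)$ is the space of bounded linear operators $X\to X$. For $A\subset\mathbb N$: $\underline{\mathrm{dens}}(A)=\liminf_{n\to\infty}\frac{\mathrm{card}(A\cap[1,n])}{n}$, $\overline{\mathrm{dens}}(A)=\limsup_{n\to\infty}\frac{\mathrm{card}(A\cap[1,n])}{n}$, $\overline{\mathrm{Bd}}(A)=\lim_{n\to\infty}\limsup_{m\to\infty}\frac{\mathrm{card}(A\cap[m+1,m+n])}{n}$, $\underline{\mathrm{Bd}}(A)=\lim_{n\to\infty}\liminf_{m\to\infty}\frac{\mathrm{card}(A\cap[m+1,m+n])}{n}$. For $x,y\in X$ and $\delta>0$ put $D_{x,y}(\delta)=\{j\in\mathbb N:\|T^jx-T^jy\|<\delta\}$ and $F_{x,y}(\delta)=\underline{\mathrm{dens}}(D_{x,y}(\delta))$, $F^*_{x,y}(\delta)=\overline{\mathrm{dens}}(D_{x,y}(\delta))$, $BF_{x,y}(\delta)=\underline{\mathrm{Bd}}(D_{x,y}(\delta))$, $BF^*_{x,y}(\delta)=\overline{\mathrm{Bd}}(D_{x,y}(\delta))$. $T$ is distributionally chaotic of type $2\frac12$ (DC$2\frac12$) if there is an uncountable set $\Gamma\subset X$ such that for every pair $(x,y)$ of distinct points of $\Gamma$ there exist $c>0$ and $r>0$ with $F_{x,y}(\delta)<c<F^*_{x,y}(\delta)$ for all $0<\delta<r$.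 $T$ is reiteratively distributionally chaotic of type $1$ if there exist an uncountable set $\Gamma\subset X$ and $\varepsilon>0$ such that for all distinct $x,y\in\Gamma$, $BF_{x,y}(\varepsilon)=0$ and there exist $c>0$ and $r>0$ with $c\le F^*_{x,y}(\delta)$ for all $0<\delta<r$. It is of type $2$ if there exist an uncountable $\Gamma\subset X$ and $\varepsilon>0$ such that for all distinct $x,y\in\Gamma$, $BF^*_{x,y}(\delta)=1$ for all $\delta>0$ and $F_{x,y}(\varepsilon)<1$. *)

theory Defs
  imports "HOL-Analysis.Analysis"
begin

text \<open>
  Densities take values in \<^typ>\<open>ereal\<close>, where \<^const>\<open>liminf\<close> and \<^const>\<open>limsup\<close> are always
  meaningful; all values lie in the interval from 0 to 1.  Only the elements \<open>j \<ge> 1\<close> of a set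
  of naturals are ever counted, so it is immaterial whether 0 is a natural number.
\<close>

definition lower_density :: "nat set \<Rightarrow> ereal" where
  "lower_density A = liminf (\<lambda>n. ereal (real (card (A \<inter> {1..n})) / real n))"

definition upper_density :: "nat set \<Rightarrow> ereal" where
  "upper_density A = limsup (\<lambda>n. ereal (real (card (A \<inter> {1..n})) / real n))"

text \<open>
  The outer limits below exist for every \<open>A\<close>: for fixed \<open>A\<close>, the inner limsup (resp. liminf) of
  the cardinalities is subadditive (resp. superadditive) in the window length \<open>n\<close>.
\<close>

definition upper_Banach_density :: "nat set \<Rightarrow> ereal" where
  "upper_Banach_density A =
     lim (\<lambda>n. limsup (\<lambda>m. ereal (real (card (A \<inter> {m+1..m+n})) / real n)))"

definition lower_Banach_density :: "nat set \<Rightarrow> ereal" where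
  "lower_Banach_density A =
     lim (\<lambda>n. liminf (\<lambda>m. ereal (real (card (A \<inter> {m+1..m+n})) / real n)))"

text \<open>
  The scalar field is \<open>\<real>\<close>; a complex Banach space is covered by restriction of scalars, since
  none of the notions below involves the scalars.
\<close>

definition close_times :: "('a::real_normed_vector \<Rightarrow>\<^sub>L 'a) \<Rightarrow> 'a \<Rightarrow> 'a \<Rightarrow> real \<Rightarrow> nat set" where
  "close_times T x y \<delta> =
     {j. norm ((blinfun_apply T ^^ j) x - (blinfun_apply T ^^ j) y) < \<delta>}"

definition F_lower :: "('a::real_normed_vector \<Rightarrow>\<^sub>L 'a) \<Rightarrow> 'a \<Rightarrow> 'a \<Rightarrow> real \<Rightarrow> ereal" where
  "F_lower T x y \<delta> = lower_density (close_times T x y \<delta>)"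

definition F_upper :: "('a::real_normed_vector \<Rightarrow>\<^sub>L 'a) \<Rightarrow> 'a \<Rightarrow> 'a \<Rightarrow> real \<Rightarrow> ereal" where
  "F_upper T x y \<delta> = upper_density (close_times T x y \<delta>)"

definition BF_lower :: "('a::real_normed_vector \<Rightarrow>\<^sub>L 'a) \<Rightarrow> 'a \<Rightarrow> 'a \<Rightarrow> real \<Rightarrow> ereal" where
  "BF_lower T x y \<delta> = lower_Banach_density (close_times T x y \<delta>)"

definition BF_upper :: "('a::real_normed_vector \<Rightarrow>\<^sub>L 'a) \<Rightarrow> 'a \<Rightarrow> 'a \<Rightarrow> real \<Rightarrow> ereal" where
  "BF_upper T x y \<delta> = upper_Banach_density (close_times T x y \<delta>)"

definition DC_two_and_half :: "('a::real_normed_vector \<Rightarrow>\<^sub>L 'a) \<Rightarrow> bool" where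
  "DC_two_and_half T \<longleftrightarrow>
     (\<exists>\<Gamma>. uncountable \<Gamma> \<and>
        (\<forall>x\<in>\<Gamma>. \<forall>y\<in>\<Gamma>. x \<noteq> y \<longrightarrow>
           (\<exists>c>0. \<exists>r>0. \<forall>\<delta>. 0 < \<delta> \<and> \<delta> < r \<longrightarrow>
              F_lower T x y \<delta> < ereal c \<and> ereal c < F_upper T x y \<delta>)))"

definition reiteratively_DC1 :: "('a::real_normed_vector \<Rightarrow>\<^sub>L 'a) \<Rightarrow> bool" where
  "reiteratively_DC1 T \<longleftrightarrow>
     (\<exists>\<Gamma>. uncountable \<Gamma> \<and> (\<exists>\<epsilon>>0.
        \<forall>x\<in>\<Gamma>. \<forall>y\<in>\<Gamma>. x \<noteq> y \<longrightarrow>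
           BF_lower T x y \<epsilon> = 0 \<and>
           (\<exists>c>0. \<exists>r>0. \<forall>\<delta>. 0 < \<delta> \<and> \<delta> < r \<longrightarrow> ereal c \<le> F_upper T x y \<delta>)))"

definition reiteratively_DC2 :: "('a::real_normed_vector \<Rightarrow>\<^sub>L 'a) \<Rightarrow> bool" where
  "reiteratively_DC2 T \<longleftrightarrow>
     (\<exists>\<Gamma>. uncountable \<Gamma> \<and> (\<exists>\<epsilon>>0.
        \<forall>x\<in>\<Gamma>. \<forall>y\<in>\<Gamma>. x \<noteq> y \<longrightarrow>
           (\<forall>\<delta>>0. BF_upper T x y \<delta> = 1) \<and> F_lower T x y \<epsilon> < 1))"

end

theory Submission imports Defs begin

text \<open>
  A single pair of the given set suffices.  Its difference \<open>u\<close> satisfies \<open>F\<^sub>u(\<delta>\<^sub>0) < 1\<close> for some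
  \<open>\<delta>\<^sub>0\<close> and \<open>F\<^sup>*\<^sub>u(\<delta>) > c\<close> for all small \<open>\<delta>\<close>.  The vectors whose orbit is dominated by a multiple of
  the orbit of \<open>u\<close> form a subspace containing every \<open>T\<^sup>k u\<close>.  In its closure, a generic vector \<open>v\<close> is
  still close to 0 with upper density at least \<open>c\<close>; and, since \<open>u\<close> has iterates \<open>T\<^sup>k u\<close> tending
  to 0 along which the densities do not change, a condensation of singularities shows that the
  orbit of \<open>v\<close> exceeds \<^emph>\<open>every\<close> bound with a fixed positive upper density.  The line
  through \<open>v\<close> is then a scrambled set of both types: by boundedness of \<open>T\<close>, a very large
  iterate is preceded by, and a very small iterate is followed by, a long block of large
  or small iterates, which determines the Banach densities.
\<close>

section \<open>Sets of positive upper density\<close>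

text \<open>Lies between upper density above \<open>a\<close> and upper density at least
  \<open>a\<close>. Unlike a limsup it is a countable intersection, over \<open>n\<close>, of
  conditions each witnessed by finitely many times, the form that a category argument needs.\<close>

definition frequent :: "real \<Rightarrow> nat set \<Rightarrow> bool" where
  "frequent a A \<longleftrightarrow> (\<forall>n. \<exists>N\<ge>n. a * real N < real (card (A \<inter> {1..N})))"

lemma frequent_mono:
  assumes "frequent a A" "A \<subseteq> B"
  shows "frequent a B"
proof -
  have "card (A \<inter> {1..N}) \<le> card (B \<inter> {1..N})" for N
    by (rule card_mono) (use assms in auto)
  then show ?thesis
    using assms(1) unfolding frequent_def by (meson less_le_trans of_nat_mono)
qed

lemma frequent_infinite:
  assumes "frequent a A" "0 < a"
  shows "infinite A"
proof
  assume fin: "finite A"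
  obtain n where n: "real (card A) / a < real n"
    using reals_Archimedean2 by blast
  obtain N where N: "N \<ge> n" "a * real N < real (card (A \<inter> {1..N}))"
    using assms(1) unfolding frequent_def by blast
  have "card (A \<inter> {1..N}) \<le> card A"
    by (rule card_mono[OF fin]) auto
  moreover have "real (card A) < a * real n"
    using n assms(2) by (simp add: field_simps)
  moreover have "a * real n \<le> a * real N"
    using N(1) assms(2) by simp
  ultimately show False
    using N(2) by linarith
qed

lemma frequent_if_less_upper_density:
  assumes "ereal c < upper_density A"
  shows "frequent c A"
  unfolding frequent_def
proof
  fix n
  show "\<exists>N\<ge>n. c * real N < real (card (A \<inter> {1..N}))"
  proof (rule ccontr)
    assume neg: "\<not> ?thesis"
    have "eventually (\<lambda>N. ereal (real (card (A \<inter> {1..N})) / real N) \<le> ereal c) sequentially"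
      using eventually_ge_at_top[of n] eventually_gt_at_top[of 0]
      by eventually_elim (use neg in \<open>force simp: field_simps\<close>)
    then have "upper_density A \<le> ereal c"
      unfolding upper_density_def by (rule Limsup_bounded)
    with assms show False by simp
  qed
qed

lemma le_upper_density_if_frequent:
  assumes "frequent c A"
  shows "ereal c \<le> upper_density A"
proof (rule ccontr)
  assume "\<not> ?thesis"
  then have "upper_density A < ereal c" by simp
  then have "eventually (\<lambda>N. ereal (real (card (A \<inter> {1..N})) / real N) < ereal c) sequentially"
    unfolding upper_density_def by (rule Limsup_lessD)
  then obtain n where n: "\<And>N. N \<ge> n \<Longrightarrow> real (card (A \<inter> {1..N})) / real N < c"
    unfolding eventually_sequentially by auto
  \<comment> \<open>\<open>Suc n\<close> keeps \<open>N\<close> positive, so that the denominator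
    can be cleared.\<close>
  obtain N where N: "N \<ge> Suc n" "c * real N < real (card (A \<inter> {1..N}))"
    using assms unfolding frequent_def by blast
  with n[of N] show False by (simp add: field_simps)
qed

lemma card_Compl_Int_atLeastAtMost:
  "real (card (- A \<inter> {1..N})) = real N - real (card (A \<inter> {1..N}))"
proof -
  have "{1..N} = (A \<inter> {1..N}) \<union> (- A \<inter> {1..N})" by blast
  then have "card {1..N} = card (A \<inter> {1..N}) + card (- A \<inter> {1..N})"
    using card_Un_disjoint[of "A \<inter> {1..N}" "- A \<inter> {1..N}"] by auto
  then show ?thesis by simp
qed

text \<open>The counts of \<open>A\<close> and \<open>- A\<close> in \<open>{1..N}\<close> add up to
  \<open>N\<close>, so few hits of \<open>A\<close> mean many of \<open>- A\<close>.\<close>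

lemma frequent_Compl_if_lower_density_less:
  assumes "lower_density A < ereal c"
  shows "frequent (1 - c) (- A)"
  unfolding frequent_def
proof
  fix n
  show "\<exists>N\<ge>n. (1 - c) * real N < real (card (- A \<inter> {1..N}))"
  proof (rule ccontr)
    assume neg: "\<not> ?thesis"
    have "eventually (\<lambda>N. ereal c \<le> ereal (real (card (A \<inter> {1..N})) / real N)) sequentially"
      using eventually_ge_at_top[of n] eventually_gt_at_top[of 0]
    proof eventually_elim
      case (elim N)
      then have "real (card (- A \<inter> {1..N})) \<le> (1 - c) * real N"
        using neg by (meson not_less)
      then show ?case
        unfolding card_Compl_Int_atLeastAtMost using elim by (simp add: field_simps)
    qed
    then have "ereal c \<le> lower_density A"
      unfolding lower_density_def by (rule Liminf_bounded)
    with assms show False by simp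
  qed
qed

lemma lower_density_less_one_if_frequent_Compl:
  assumes "frequent a (- A)" "0 < a"
  shows "lower_density A < 1"
proof (rule ccontr)
  assume "\<not> ?thesis"
  then have "ereal (1 - a) < lower_density A"
    using assms(2) by (cases "lower_density A") auto
  then have "eventually (\<lambda>N. ereal (1 - a) < ereal (real (card (A \<inter> {1..N})) / real N)) sequentially"
    unfolding lower_density_def by (rule less_LiminfD)
  then obtain n where n: "\<And>N. N \<ge> n \<Longrightarrow> 1 - a < real (card (A \<inter> {1..N})) / real N"
    unfolding eventually_sequentially by auto
  obtain N where N: "N \<ge> Suc n" "a * real N < real (card (- A \<inter> {1..N}))"
    using assms(1) unfolding frequent_def by blast
  with n[of N] show False
    unfolding card_Compl_Int_atLeastAtMost by (simp add: field_simps)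
qed

text \<open>Shifting loses at most \<open>k\<close> initial elements and shortens the window by
  \<open>k\<close>; the gap between \<open>a\<close> and \<open>b\<close> absorbs this bounded loss
  once the window is long.\<close>

lemma frequent_shift:
  assumes "frequent a A" "0 < a" "b < a"
  shows "frequent b {j. j + k \<in> A}"
  unfolding frequent_def
proof
  fix n
  obtain n' where n': "real k / (a - b) < real n'"
    using reals_Archimedean2 by blast
  obtain N where N: "N \<ge> max n n' + k" "a * real N < real (card (A \<inter> {1..N}))"
    using assms(1) unfolding frequent_def by blast
  define M where "M = N - k"
  have M: "N = M + k" "M \<ge> n" "M \<ge> n'"
    using N(1) by (auto simp: M_def)
  have "A \<inter> {1..N} \<subseteq> {1..k} \<union> (\<lambda>j. j + k) ` ({j. j + k \<in> A} \<inter> {1..M})"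
  proof
    fix i assume i: "i \<in> A \<inter> {1..N}"
    show "i \<in> {1..k} \<union> (\<lambda>j. j + k) ` ({j. j + k \<in> A} \<inter> {1..M})"
    proof (cases "i \<le> k")
      case False
      then have "i = (i - k) + k" "i - k \<in> {j. j + k \<in> A} \<inter> {1..M}"
        using i M(1) by auto
      then show ?thesis by blast
    qed (use i in auto)
  qed
  then have "card (A \<inter> {1..N}) \<le> card ({1..k} \<union> (\<lambda>j. j + k) ` ({j. j + k \<in> A} \<inter> {1..M}))"
    by (intro card_mono) auto
  also have "\<dots> \<le> card {1..k} + card ((\<lambda>j. j + k) ` ({j. j + k \<in> A} \<inter> {1..M}))"
    by (rule card_Un_le)
  also have "\<dots> \<le> k + card ({j. j + k \<in> A} \<inter> {1..M})"
    using card_image_le[of "{j. j + k \<in> A} \<inter> {1..M}" "\<lambda>j. j + k"] by simp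
  finally have card: "real (card (A \<inter> {1..N})) \<le> real k + real (card ({j. j + k \<in> A} \<inter> {1..M}))"
    by linarith
  have "real k < (a - b) * real n'"
    using n' assms(3) by (simp add: field_simps)
  also have "\<dots> \<le> (a - b) * real M"
    using M(3) assms(3) by (intro mult_left_mono) auto
  finally have "b * real M < a * real M - real k"
    by (simp add: algebra_simps)
  moreover have "a * real M \<le> a * real N"
    using M(1) assms(2) by simp
  ultimately have "b * real M < real (card ({j. j + k \<in> A} \<inter> {1..M}))"
    using N(2) card by linarith
  with M(2) show "\<exists>N\<ge>n. b * real N < real (card ({j. j + k \<in> A} \<inter> {1..N}))"
    by blast
qed

section \<open>Orbits of bounded operators\<close>

lemma bounded_linear_funpow_blinfun:
  fixes T :: "'a::real_normed_vector \<Rightarrow>\<^sub>L 'a"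
  shows "bounded_linear (blinfun_apply T ^^ j)"
proof (induction j)
  case 0
  show ?case using bounded_linear_ident by (simp add: id_def)
next
  case (Suc j)
  then show ?case
    using bounded_linear_compose[OF blinfun.bounded_linear_right[of T] Suc] by (simp add: comp_def)
qed

text \<open>\<open>M\<close> may be any bound on the norm, so that it can be taken at least 1, where
  its powers increase.\<close>

lemma norm_funpow_blinfun_le:
  fixes T :: "'a::real_normed_vector \<Rightarrow>\<^sub>L 'a"
  assumes "norm T \<le> M"
  shows "norm ((blinfun_apply T ^^ j) x) \<le> M ^ j * norm x"
proof (induction j)
  case (Suc j)
  have "norm (blinfun_apply T ((blinfun_apply T ^^ j) x)) \<le> norm T * norm ((blinfun_apply T ^^ j) x)"
    by (rule norm_blinfun)
  also have "\<dots> \<le> M * (M ^ j * norm x)"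
    using Suc assms order_trans[OF norm_ge_zero assms] by (intro mult_mono) auto
  finally show ?case by (simp add: mult.assoc)
qed simp

text \<open>In \<open>n\<close> steps norms grow at most by the factor \<open>M ^ n\<close>, so one
  iterate below \<open>\<delta> / M ^ n\<close> keeps the next \<open>n\<close> below
  \<delta>.\<close>

lemma small_block:
  fixes T :: "'a::real_normed_vector \<Rightarrow>\<^sub>L 'a"
  assumes small: "\<And>d. 0 < d \<Longrightarrow> infinite {j. norm ((blinfun_apply T ^^ j) v) < d}"
    and "0 < \<delta>"
  shows "\<exists>m\<ge>k. \<forall>j\<in>{m+1..m+n}. norm ((blinfun_apply T ^^ j) v) < \<delta>"
proof -
  define M where "M = max 1 (norm T)"
  have M: "norm T \<le> M" "1 \<le> M" by (auto simp: M_def)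
  have "0 < \<delta> / M ^ n" using assms(2) M by simp
  from small[OF this] obtain m where m: "m \<ge> k" "norm ((blinfun_apply T ^^ m) v) < \<delta> / M ^ n"
    unfolding infinite_nat_iff_unbounded_le by auto
  have "norm ((blinfun_apply T ^^ j) v) < \<delta>" if j: "j \<in> {m+1..m+n}" for j
  proof -
    have "(blinfun_apply T ^^ j) v = (blinfun_apply T ^^ (j - m)) ((blinfun_apply T ^^ m) v)"
      using j by (simp flip: funpow_add comp_apply[of "blinfun_apply T ^^ (j - m)"])
    then have "norm ((blinfun_apply T ^^ j) v) \<le> M ^ (j - m) * norm ((blinfun_apply T ^^ m) v)"
      using norm_funpow_blinfun_le[OF M(1)] by simp
    also have "\<dots> \<le> M ^ n * norm ((blinfun_apply T ^^ m) v)"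
      using j M by (intro mult_right_mono power_increasing) auto
    also have "\<dots> < \<delta>"
      using m(2) M by (simp add: field_simps)
    finally show ?thesis .
  qed
  with m(1) show ?thesis by blast
qed

text \<open>The same growth bound read backwards: an iterate above
  \<open>M ^ n * \<bar>\<delta>\<bar>\<close> cannot be reached within \<open>n\<close> steps from a
  vector of norm below \<delta>.\<close>

lemma large_block:
  fixes T :: "'a::real_normed_vector \<Rightarrow>\<^sub>L 'a"
  assumes large: "\<And>s. infinite {j. s < norm ((blinfun_apply T ^^ j) v)}"
  shows "\<exists>m\<ge>k. \<forall>j\<in>{m+1..m+n}. \<delta> \<le> norm ((blinfun_apply T ^^ j) v)"
proof -
  define M where "M = max 1 (norm T)"
  have M: "norm T \<le> M" "1 \<le> M" by (auto simp: M_def)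
  \<comment> \<open>The block ends at \<open>p\<close>; \<open>p \<ge> k + n\<close> makes the
    natural subtraction \<open>p - n\<close> exact and at least \<open>k\<close>.\<close>
  from large[of "M ^ n * \<bar>\<delta>\<bar>"] obtain p
    where p: "p \<ge> k + n" "M ^ n * \<bar>\<delta>\<bar> < norm ((blinfun_apply T ^^ p) v)"
    unfolding infinite_nat_iff_unbounded_le by auto
  have "\<delta> \<le> norm ((blinfun_apply T ^^ j) v)" if j: "j \<in> {p-n+1..p-n+n}" for j
  proof -
    have "j \<le> p" using j p(1) by auto
    then have "(blinfun_apply T ^^ p) v = (blinfun_apply T ^^ (p - j)) ((blinfun_apply T ^^ j) v)"
      by (simp flip: funpow_add comp_apply[of "blinfun_apply T ^^ (p - j)"])
    then have "norm ((blinfun_apply T ^^ p) v) \<le> M ^ (p - j) * norm ((blinfun_apply T ^^ j) v)"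
      using norm_funpow_blinfun_le[OF M(1)] by simp
    also have "\<dots> \<le> M ^ n * norm ((blinfun_apply T ^^ j) v)"
      using j p(1) M by (intro mult_right_mono power_increasing) auto
    finally have "M ^ n * \<bar>\<delta>\<bar> < M ^ n * norm ((blinfun_apply T ^^ j) v)"
      using p(2) by linarith
    then show ?thesis using M by simp
  qed
  moreover have "p - n \<ge> k" using p(1) by simp
  ultimately show ?thesis by blast
qed

section \<open>Banach densities of sets with long blocks or gaps\<close>

lemma upper_Banach_density_eq_one:
  assumes "\<And>n k. \<exists>m\<ge>k. {m+1..m+n} \<subseteq> A"
  shows "upper_Banach_density A = 1"
proof -
  \<comment> \<open>A window of length 0 has quotient 0, so \<open>n = 0\<close> is excluded; the
    outer limit ignores this one exception.\<close>
  have "limsup (\<lambda>m. ereal (real (card (A \<inter> {m+1..m+n})) / real n)) = 1" if "n > 0" for n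
  proof (rule antisym)
    have "card (A \<inter> {m+1..m+n}) \<le> n" for m
      using card_mono[of "{m+1..m+n}" "A \<inter> {m+1..m+n}"] by simp
    then show "limsup (\<lambda>m. ereal (real (card (A \<inter> {m+1..m+n})) / real n)) \<le> 1"
      using that by (intro Limsup_bounded) (auto simp: divide_le_eq_1)
    show "1 \<le> limsup (\<lambda>m. ereal (real (card (A \<inter> {m+1..m+n})) / real n))"
    proof (rule ccontr)
      assume "\<not> ?thesis"
      then have "eventually (\<lambda>m. ereal (real (card (A \<inter> {m+1..m+n})) / real n) < 1) sequentially"
        by (intro Limsup_lessD) simp
      then obtain k where k: "\<And>m. m \<ge> k \<Longrightarrow> real (card (A \<inter> {m+1..m+n})) / real n < 1"
        unfolding eventually_sequentially by auto
      obtain m where m: "m \<ge> k" "{m+1..m+n} \<subseteq> A"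
        using assms by blast
      then have "A \<inter> {m+1..m+n} = {m+1..m+n}" by blast
      with k[OF m(1)] that show False by simp
    qed
  qed
  then have "(\<lambda>n. limsup (\<lambda>m. ereal (real (card (A \<inter> {m+1..m+n})) / real n))) \<longlonglongrightarrow> 1"
    by (intro tendsto_eventually eventually_mono[OF eventually_gt_at_top[of 0]])
  then show ?thesis
    unfolding upper_Banach_density_def by (rule limI)
qed

lemma lower_Banach_density_eq_zero:
  assumes "\<And>n k. \<exists>m\<ge>k. A \<inter> {m+1..m+n} = {}"
  shows "lower_Banach_density A = 0"
proof -
  have "liminf (\<lambda>m. ereal (real (card (A \<inter> {m+1..m+n})) / real n)) = 0" for n
  proof (rule antisym)
    show "0 \<le> liminf (\<lambda>m. ereal (real (card (A \<inter> {m+1..m+n})) / real n))"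
      by (intro Liminf_bounded) auto
    show "liminf (\<lambda>m. ereal (real (card (A \<inter> {m+1..m+n})) / real n)) \<le> 0"
    proof (rule ccontr)
      assume "\<not> ?thesis"
      then have "eventually (\<lambda>m. 0 < ereal (real (card (A \<inter> {m+1..m+n})) / real n)) sequentially"
        by (intro less_LiminfD) simp
      then obtain k where k: "\<And>m. m \<ge> k \<Longrightarrow> 0 < real (card (A \<inter> {m+1..m+n})) / real n"
        unfolding eventually_sequentially by auto
      obtain m where m: "m \<ge> k" "A \<inter> {m+1..m+n} = {}"
        using assms by blast
      with k[OF m(1)] show False by simp
    qed
  qed
  then show ?thesis
    unfolding lower_Banach_density_def by (simp add: limI)
qed

section \<open>A generic vector\<close>

text \<open>A closed subset of a complete space is completely metrizable, so Baire's theorem applies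
  inside \<open>Y\<close> to the traces \<open>Y \<inter> G\<close>.\<close>

lemma Baire_closed_subset:
  fixes Y :: "'a::complete_space set"
  assumes "closed Y" "Y \<noteq> {}" "countable \<G>"
    and G: "\<And>G. G \<in> \<G> \<Longrightarrow> open G \<and> Y \<subseteq> closure (Y \<inter> G)"
  shows "\<exists>v\<in>Y. \<forall>G\<in>\<G>. v \<in> G"
proof (cases "\<G> = {}")
  case False
  have "top_of_set Y closure_of \<Inter>((\<inter>) Y ` \<G>) = topspace (top_of_set Y)"
  proof (rule Baire_category)
    show "completely_metrizable_space (top_of_set Y) \<or>
        locally_compact_space (top_of_set Y) \<and> regular_space (top_of_set Y)"
      using completely_metrizable_space_closedin[OF completely_metrizable_space_euclidean] assms(1)
      by auto
    show "countable ((\<inter>) Y ` \<G>)" using assms(3) by blast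
    fix V assume "V \<in> (\<inter>) Y ` \<G>"
    then obtain G' where G': "G' \<in> \<G>" "V = Y \<inter> G'" by blast
    have "top_of_set Y closure_of V = Y \<inter> closure (Y \<inter> G')"
      using G' by (simp add: closure_of_subtopology flip: Int_assoc)
    with G[OF G'(1)] G'(2) show
      "openin (top_of_set Y) V \<and> top_of_set Y closure_of V = topspace (top_of_set Y)"
      by auto
  qed
  with assms(2) have "\<Inter>((\<inter>) Y ` \<G>) \<noteq> {}" by force
  \<comment> \<open>A nonempty family puts the common point into \<open>Y\<close>; the intersection
    of no sets is the whole type.\<close>
  with False show ?thesis by blast
qed (use assms(2) in blast)

text \<open>The count exceeds its bound iff some large enough finite set \<open>J\<close> consists
  of hits, and for fixed \<open>J\<close> this is a finite intersection of open preimages.\<close>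

lemma open_frequent_hitting:
  fixes f :: "nat \<Rightarrow> 'a::topological_space \<Rightarrow> 'b::topological_space"
  assumes "\<And>j. continuous_on UNIV (f j)" "open U"
  shows "open {v. \<exists>N\<ge>n. a * real N < real (card ({j. f j v \<in> U} \<inter> {1..N}))}"
proof -
  have "{v. \<exists>N\<ge>n. a * real N < real (card ({j. f j v \<in> U} \<inter> {1..N}))} =
      (\<Union>N\<in>{n..}. \<Union>J\<in>{J. J \<subseteq> {1..N} \<and> a * real N < real (card J)}. \<Inter>j\<in>J. f j -` U)"
    (is "?L = ?R")
  proof
    show "?L \<subseteq> ?R"
    proof
      fix v assume "v \<in> ?L"
      then obtain N where "N \<ge> n" "a * real N < real (card ({j. f j v \<in> U} \<inter> {1..N}))" by blast
      then show "v \<in> ?R"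
        by (intro UN_I[of N] UN_I[of "{j. f j v \<in> U} \<inter> {1..N}"]) auto
    qed
    show "?R \<subseteq> ?L"
    proof
      fix v assume "v \<in> ?R"
      then obtain N J where NJ: "N \<ge> n" "J \<subseteq> {1..N}" "a * real N < real (card J)"
        "\<And>j. j \<in> J \<Longrightarrow> f j v \<in> U" by auto
      then have "card J \<le> card ({j. f j v \<in> U} \<inter> {1..N})"
        by (intro card_mono) auto
      with NJ show "v \<in> ?L" by (force intro: less_le_trans)
    qed
  qed
  also have "open \<dots>"
  proof (intro open_UN ballI)
    fix N J assume "J \<in> {J. J \<subseteq> {1..N} \<and> a * real N < real (card J)}"
    then have "finite J" by (auto intro: finite_subset)
    then show "open (\<Inter>j\<in>J. f j -` U)"
      using assms by (intro open_INT ballI open_vimage) auto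
  qed
  finally show ?thesis .
qed

text \<open>Both conclusions are countable families of open conditions, each dense in the closure of
  \<open>S\<close>. The constant \<open>b/4\<close> comes from two halvings: one pays for a time
  shift, one for the choice between \<open>w + x\<close> and \<open>w - x\<close>.\<close>

lemma exists_generic_vector:
  fixes T :: "'a::banach \<Rightarrow>\<^sub>L 'a" and u :: 'a
  assumes "0 < \<delta>" "0 < b" "0 < c"
    and away: "frequent b {j. \<delta> \<le> norm ((blinfun_apply T ^^ j) u)}"
    and near: "\<And>d. 0 < d \<Longrightarrow> frequent c {j. norm ((blinfun_apply T ^^ j) u) < d}"
  shows "\<exists>v. (\<forall>s. frequent (b/4) {j. s < norm ((blinfun_apply T ^^ j) v)}) \<and>
             (\<forall>d>0. frequent c {j. norm ((blinfun_apply T ^^ j) v) < d})"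
proof -
  define P where "P = (\<lambda>j. blinfun_apply T ^^ j)"
  interpret P: bounded_linear "P j" for j
    unfolding P_def by (rule bounded_linear_funpow_blinfun)
  have cont: "continuous_on UNIV (P j)" for j
    by (rule P.continuous_on[OF continuous_on_id])
  \<comment> \<open>Domination carries the small times of \<open>u\<close> over to every vector of
    \<open>S\<close>, whatever the constant \<open>K\<close>.\<close>
  define S where "S = {w. \<exists>K. \<forall>j. norm (P j w) \<le> K * norm (P j u)}"
  define G where "G = (\<lambda>a U n. {v. \<exists>N\<ge>n. a * real N < real (card ({j. P j v \<in> U} \<inter> {1..N}))})"
  \<comment> \<open>Integer thresholds and their reciprocals suffice by monotonicity and keep the
    family countable.\<close>
  define \<G> where "\<G> = (\<Union>i n::nat. {G (b/4) {x. real i < norm x} n}) \<union>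
    (\<Union>i n::nat. {G c {x. norm x < 1 / real (Suc i)} n})"
  have open_G: "open (G a U n)" if "open U" for a U n
    unfolding G_def by (rule open_frequent_hitting[OF cont that])
  \<comment> \<open>A vector \<open>w\<close> of \<open>S\<close> is perturbed by a small multiple
    \<open>x\<close> of some \<open>P k u\<close>, whose orbit is nevertheless often large.\<close>
  have dense_large: "S \<subseteq> closure (S \<inter> G (b/4) {x. real i < norm x} n)" for i n
  proof
    fix w assume w: "w \<in> S"
    show "w \<in> closure (S \<inter> G (b/4) {x. real i < norm x} n)"
      unfolding closure_approachable
    proof (intro allI impI)
      fix e :: real assume e: "0 < e"
      \<comment> \<open>With this \<open>l\<close>, a time when \<open>P (j + k) u\<close> has norm
        at least \<delta> gives \<open>P j x\<close> norm at least \<open>i + 1\<close>; the extra 1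
        yields a strict bound by \<open>i\<close>.\<close>
      define l where "l = (real i + 1) / \<delta>"
      have l: "0 < l" "l * \<delta> = real i + 1" using assms(1) by (auto simp: l_def)
      \<comment> \<open>Only now is \<open>k\<close> chosen, depending on \<open>l\<close>, so that
        \<open>x\<close> stays below \<open>e\<close> despite the large factor.\<close>
      have "infinite {j. norm (P j u) < e / l}"
        using frequent_infinite[OF near[of "e / l"]] e l assms(3) by (simp add: P_def)
      then obtain k where k: "norm (P k u) < e / l"
        by (auto dest: not_finite_existsD)
      define x where "x = l *\<^sub>R P k u"
      have "norm x = l * norm (P k u)" using l by (simp add: x_def)
      also have "\<dots> < e" using k l by (simp add: field_simps)
      finally have x_small: "norm x < e" .
      \<comment> \<open>Commuting the powers lets the bound \<open>B\<close> of \<open>P k\<close>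
        dominate the orbit of \<open>P k u\<close> by that of \<open>u\<close>, which keeps
        \<open>x\<close> in \<open>S\<close>.\<close>
      have shift: "P j (P k u) = P k (P j u)" for j
        unfolding P_def by (simp flip: funpow_add comp_apply[of "blinfun_apply T ^^ _"] add: add.commute)
      obtain B where B: "\<And>z. norm (P k z) \<le> norm z * B"
        using P.bounded[of k] by auto
      obtain K where K: "\<And>j. norm (P j w) \<le> K * norm (P j u)"
        using w unfolding S_def by blast
      have x_dom: "norm (P j x) \<le> (l * B) * norm (P j u)" for j
        using mult_left_mono[OF B[of "P j u"], of l] l
        by (simp add: x_def P.scaleR shift mult_ac)
      have "norm (P j (w + x)) \<le> (K + l * B) * norm (P j u)"
        "norm (P j (w - x)) \<le> (K + l * B) * norm (P j u)" for j
        using K[of j] x_dom[of j] norm_triangle_ineq[of "P j w" "P j x"]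
          norm_triangle_ineq4[of "P j w" "P j x"]
        by (simp_all add: P.add P.diff algebra_simps)
      then have in_S: "w + x \<in> S" "w - x \<in> S"
        unfolding S_def by (auto intro!: exI[of _ "K + l * B"])
      have "frequent (b/2) {j. j + k \<in> {j. \<delta> \<le> norm (P j u)}}"
        by (rule frequent_shift[where a = b]) (use away assms in \<open>simp_all add: P_def\<close>)
      then obtain N where N: "N \<ge> n"
        "b/2 * real N < real (card ({j. j + k \<in> {j. \<delta> \<le> norm (P j u)}} \<inter> {1..N}))"
        unfolding frequent_def by blast
      define H where "H = (\<lambda>v. {j. P j v \<in> {x. real i < norm x}} \<inter> {1..N})"
      \<comment> \<open>\<open>P j (w + x)\<close> and \<open>P j (w - x)\<close> differ by \<open>2 P j x\<close>, so at most one of them is small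
        whenever \<open>P j x\<close> is large; hence \<open>w + x\<close> or \<open>w - x\<close> catches half of these times.\<close>
      have "{j. j + k \<in> {j. \<delta> \<le> norm (P j u)}} \<inter> {1..N} \<subseteq> H (w + x) \<union> H (w - x)"
      proof
        fix j assume j: "j \<in> {j. j + k \<in> {j. \<delta> \<le> norm (P j u)}} \<inter> {1..N}"
        have "P (j + k) u = P j (P k u)"
          by (simp add: P_def funpow_add)
        then have "norm (P j x) = l * norm (P (j + k) u)"
          using l by (simp add: x_def P.scaleR)
        then have "real i + 1 \<le> norm (P j x)"
          using j l mult_left_mono[of \<delta> "norm (P (j + k) u)" l] by auto
        moreover have "norm (P j (w + x) - P j (w - x)) = 2 * norm (P j x)"
          by (simp add: P.add P.diff flip: scaleR_2)
        moreover have "norm (P j (w + x) - P j (w - x)) \<le> norm (P j (w + x)) + norm (P j (w - x))"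
          by (rule norm_triangle_ineq4)
        ultimately have "real i < norm (P j (w + x)) \<or> real i < norm (P j (w - x))"
          by linarith
        with j show "j \<in> H (w + x) \<union> H (w - x)" by (auto simp: H_def)
      qed
      then have "card ({j. j + k \<in> {j. \<delta> \<le> norm (P j u)}} \<inter> {1..N}) \<le> card (H (w + x) \<union> H (w - x))"
        by (intro card_mono) (auto simp: H_def)
      also have "\<dots> \<le> card (H (w + x)) + card (H (w - x))"
        by (rule card_Un_le)
      finally have "b/4 * real N < real (card (H (w + x))) \<or> b/4 * real N < real (card (H (w - x)))"
        using N(2) by linarith
      then have "w + x \<in> G (b/4) {x. real i < norm x} n \<or> w - x \<in> G (b/4) {x. real i < norm x} n"
        using N(1) unfolding G_def H_def mem_Collect_eq
        by (elim disjE)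
          (intro disjI1 exI[of _ N] conjI; assumption | intro disjI2 exI[of _ N] conjI; assumption)+
      moreover have "dist (w + x) w < e" "dist (w - x) w < e"
        using x_small by (simp_all add: dist_norm)
      ultimately show "\<exists>y\<in>S \<inter> G (b/4) {x. real i < norm x} n. dist y w < e"
        using in_S by (elim disjE) (intro bexI IntI; assumption)+
    qed
  qed
  have dense_small: "S \<subseteq> closure (S \<inter> G c {x. norm x < 1 / real (Suc i)} n)" for i n
  proof
    fix w assume w: "w \<in> S"
    then obtain K where K: "\<And>j. norm (P j w) \<le> K * norm (P j u)"
      unfolding S_def by blast
    \<comment> \<open>The constant \<open>K\<close> need not be positive; \<open>K'\<close> is, and
      can be divided by.\<close>
    define K' where "K' = max 1 K"
    have K': "0 < K'" "norm (P j w) \<le> K' * norm (P j u)" for j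
      using K[of j] mult_right_mono[of K K' "norm (P j u)"] by (auto simp: K'_def)
    define d where "d = 1 / real (Suc i) / K'"
    have "0 < d" using K'(1) by (simp add: d_def)
    have "{j. norm (P j u) < d} \<subseteq> {j. P j w \<in> {x. norm x < 1 / real (Suc i)}}"
    proof clarify
      fix j assume "norm (P j u) < d"
      then have "K' * norm (P j u) < 1 / real (Suc i)"
        using K'(1) unfolding d_def by (simp only: pos_less_divide_eq mult.commute)
      with K'(2)[of j] show "norm (P j w) < 1 / real (Suc i)" by linarith
    qed
    moreover have "frequent c {j. norm (P j u) < d}"
      unfolding P_def by (rule near) fact
    ultimately have "frequent c {j. P j w \<in> {x. norm x < 1 / real (Suc i)}}"
      by (rule frequent_mono[rotated])
    then have "w \<in> G c {x. norm x < 1 / real (Suc i)} n"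
      by (simp add: G_def frequent_def)
    with w show "w \<in> closure (S \<inter> G c {x. norm x < 1 / real (Suc i)} n)"
      by (intro closure_subset[THEN subsetD] IntI)
  qed
  have "u \<in> S" unfolding S_def by (auto intro: exI[of _ 1])
  have "\<exists>v\<in>closure S. \<forall>A\<in>\<G>. v \<in> A"
  proof (rule Baire_closed_subset)
    show "closure S \<noteq> {}" using \<open>u \<in> S\<close> closure_subset by blast
    show "countable \<G>" unfolding \<G>_def by auto
    fix A assume "A \<in> \<G>"
    then consider i n where "A = G (b/4) {x. real i < norm x} n"
      | i n where "A = G c {x. norm x < 1 / real (Suc i)} n"
      unfolding \<G>_def by blast
    then have "open A \<and> S \<subseteq> closure (S \<inter> A)"
    proof cases
      case 1
      then show ?thesis
        using dense_large by (simp add: open_G open_Collect_less continuous_on_norm_id)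
    next
      case (2 i n)
      have "open {x::'a. norm x < 1 / real (Suc i)}"
        by (intro open_Collect_less continuous_intros)
      then show ?thesis
        unfolding 2 using dense_small open_G by blast
    qed
    \<comment> \<open>Density was shown for \<open>S\<close> only; taking closures transfers it to
      \<open>closure S\<close>.\<close>
    moreover have "closure (S \<inter> A) \<subseteq> closure (closure S \<inter> A)"
      using closure_subset by (intro closure_mono) blast
    ultimately show "open A \<and> closure S \<subseteq> closure (closure S \<inter> A)"
      by (metis closed_closure closure_minimal subset_trans)
  qed simp
  then obtain v where v: "\<And>A. A \<in> \<G> \<Longrightarrow> v \<in> A" by blast
  have "frequent (b/4) {j. s < norm (P j v)}" for s
  proof -
    obtain i where i: "s < real i" using reals_Archimedean2 by blast
    have "v \<in> G (b/4) {x. real i < norm x} n" for n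
      by (rule v) (auto simp: \<G>_def)
    then have "frequent (b/4) {j. real i < norm (P j v)}"
      by (simp add: G_def frequent_def)
    then show ?thesis
      by (rule frequent_mono) (use i in auto)
  qed
  moreover have "frequent c {j. norm (P j v) < d}" if "0 < d" for d
  proof -
    obtain i where i: "1 / real (Suc i) < d"
      using nat_approx_posE \<open>0 < d\<close> by metis
    have "v \<in> G c {x. norm x < 1 / real (Suc i)} n" for n
      by (rule v) (auto simp: \<G>_def)
    then have "frequent c {j. norm (P j v) < 1 / real (Suc i)}"
      by (simp add: G_def frequent_def)
    then show ?thesis
      by (rule frequent_mono) (use i in auto)
  qed
  ultimately show ?thesis unfolding P_def by blast
qed

section \<open>Pairs on a line and the scrambled set\<close>

lemma close_times_diff:
  fixes T :: "'a::real_normed_vector \<Rightarrow>\<^sub>L 'a"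
  shows "close_times T x y \<delta> = {j. norm ((blinfun_apply T ^^ j) (x - y)) < \<delta>}"
  unfolding close_times_def
  by (simp add: linear_diff[OF bounded_linear.linear[OF bounded_linear_funpow_blinfun]])

text \<open>Reduces all pairs on the line through \<open>v\<close> to the orbit of \<open>v\<close>
  alone, at a rescaled threshold.\<close>

lemma close_times_scaleR:
  fixes T :: "'a::real_normed_vector \<Rightarrow>\<^sub>L 'a"
  assumes "s \<noteq> t"
  shows "close_times T (s *\<^sub>R v) (t *\<^sub>R v) \<delta> =
    {j. norm ((blinfun_apply T ^^ j) v) < \<delta> / \<bar>s - t\<bar>}"
proof -
  have "norm ((blinfun_apply T ^^ j) (s *\<^sub>R v - t *\<^sub>R v)) =
      norm ((blinfun_apply T ^^ j) v) * \<bar>s - t\<bar>" for j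
    by (simp add: linear_scale[OF bounded_linear.linear[OF bounded_linear_funpow_blinfun]]
        flip: scaleR_diff_left)
  then show ?thesis
    using assms by (simp add: close_times_diff pos_less_divide_eq)
qed

theorem theorem2p5:
  fixes T :: "'a::banach \<Rightarrow>\<^sub>L 'a"
  assumes "DC_two_and_half T"
  shows "reiteratively_DC1 T \<and> reiteratively_DC2 T"
proof -
  obtain \<Gamma> where \<Gamma>: "uncountable \<Gamma>"
    "\<And>x y. x \<in> \<Gamma> \<Longrightarrow> y \<in> \<Gamma> \<Longrightarrow> x \<noteq> y \<Longrightarrow> \<exists>c>0. \<exists>r>0. \<forall>\<delta>. 0 < \<delta> \<and> \<delta> < r \<longrightarrow>
        F_lower T x y \<delta> < ereal c \<and> ereal c < F_upper T x y \<delta>"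
    using assms unfolding DC_two_and_half_def by blast
  obtain x where "x \<in> \<Gamma>" using \<Gamma>(1) by fastforce
  moreover obtain y where "y \<in> \<Gamma>" "x \<noteq> y"
    using \<Gamma>(1) by (metis countable_empty countable_insert insertCI subsetI subset_singletonD)
  ultimately obtain c r where c: "0 < c" and r: "0 < r"
    and F: "\<And>\<delta>. 0 < \<delta> \<Longrightarrow> \<delta> < r \<Longrightarrow> F_lower T x y \<delta> < ereal c \<and> ereal c < F_upper T x y \<delta>"
    using \<Gamma>(2) by metis
  define u where "u = x - y"
  define P where "P = (\<lambda>j. blinfun_apply T ^^ j)"
  have near: "frequent c {j. norm (P j u) < d}" if "0 < d" for d
  proof -
    \<comment> \<open>The hypothesis speaks only of thresholds below \<open>r\<close>; larger ones
      follow by monotonicity.\<close>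
    define d' where "d' = min d (r/2)"
    have "0 < d'" "d' < r" using that r by (auto simp: d'_def)
    then have "frequent c {j. norm (P j u) < d'}"
      using F[of d'] unfolding F_upper_def close_times_diff u_def P_def
      by (intro frequent_if_less_upper_density) blast
    then show ?thesis by (rule frequent_mono) (auto simp: d'_def)
  qed
  \<comment> \<open>Densities are at most 1, which forces \<open>c < 1\<close>; thus
    \<open>1 - c\<close> is a positive frequency of times away from 0.\<close>
  have "upper_density A \<le> 1" for A
  proof -
    have "card (A \<inter> {1..N}) \<le> N" for N
      using card_mono[of "{1..N}" "A \<inter> {1..N}"] by simp
    then show ?thesis
      unfolding upper_density_def
      by (intro Limsup_bounded always_eventually) (auto simp: divide_le_eq_1)
  qed
  moreover have "ereal c < upper_density (close_times T x y (r/2))"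
    using F[of "r/2"] r unfolding F_upper_def by simp
  ultimately have "ereal c < 1"
    by (rule less_le_trans[rotated])
  then have b: "0 < 1 - c" by simp
  have "frequent (1 - c) (- {j. norm (P j u) < r/2})"
    using F[of "r/2"] r unfolding F_lower_def close_times_diff u_def P_def
    by (intro frequent_Compl_if_lower_density_less) auto
  then have "frequent (1 - c) {j. r/2 \<le> norm (P j u)}"
    by (rule frequent_mono) auto
  then have "\<exists>v. (\<forall>s. frequent ((1 - c)/4) {j. s < norm (P j v)}) \<and>
      (\<forall>d>0. frequent c {j. norm (P j v) < d})"
    unfolding P_def
    by (intro exists_generic_vector[of "r/2" "1 - c" c T u])
      (use b c r near in \<open>simp_all add: P_def\<close>)
  then obtain v where large: "\<And>s. frequent ((1 - c)/4) {j. s < norm (P j v)}"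
    and small: "\<And>d. 0 < d \<Longrightarrow> frequent c {j. norm (P j v) < d}"
    by blast
  have inf_large: "infinite {j. s < norm ((blinfun_apply T ^^ j) v)}" for s
    using frequent_infinite[OF large] b unfolding P_def by simp
  have inf_small: "infinite {j. norm ((blinfun_apply T ^^ j) v) < d}" if "0 < d" for d
    using frequent_infinite[OF small[OF that] c] unfolding P_def .
  have "v \<noteq> 0"
  proof
    assume "v = 0"
    then have "{j. 0 < norm ((blinfun_apply T ^^ j) v)} = {}"
      by (simp add: linear_0[OF bounded_linear.linear[OF bounded_linear_funpow_blinfun]])
    with inf_large[of 0] show False by simp
  qed
  define L where "L = range (\<lambda>t::real. t *\<^sub>R v)"
  have "inj (\<lambda>t::real. t *\<^sub>R v)" using \<open>v \<noteq> 0\<close> by (auto intro: injI)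
  then have L: "uncountable L"
    unfolding L_def using countable_image_inj_eq uncountable_UNIV_real by blast
  \<comment> \<open>All four properties hold at every positive threshold, with the same
    \<open>c\<close> for all pairs, so any positive \<epsilon> and \<open>r\<close> serve
    below.\<close>
  have pair: "BF_lower T x y \<delta> = 0 \<and> ereal c \<le> F_upper T x y \<delta> \<and>
      BF_upper T x y \<delta> = 1 \<and> F_lower T x y \<delta> < 1"
    if "x \<in> L" "y \<in> L" "x \<noteq> y" "0 < \<delta>" for x y \<delta>
  proof -
    obtain s t where st: "x = s *\<^sub>R v" "y = t *\<^sub>R v" "s \<noteq> t"
      using \<open>x \<in> L\<close> \<open>y \<in> L\<close> \<open>x \<noteq> y\<close> unfolding L_def by blast
    define d where "d = \<delta> / \<bar>s - t\<bar>"
    have d: "0 < d" using \<open>0 < \<delta>\<close> st(3) by (simp add: d_def)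
    have D: "close_times T x y \<delta> = {j. norm (P j v) < d}"
      unfolding st(1,2) d_def P_def by (rule close_times_scaleR[OF st(3)])
    have "lower_Banach_density {j. norm (P j v) < d} = 0"
    proof (rule lower_Banach_density_eq_zero)
      show "\<exists>m\<ge>k. {j. norm (P j v) < d} \<inter> {m+1..m+n} = {}" for n k
        using large_block[OF inf_large, of k n d] unfolding P_def by force
    qed
    moreover have "upper_Banach_density {j. norm (P j v) < d} = 1"
    proof (rule upper_Banach_density_eq_one)
      show "\<exists>m\<ge>k. {m+1..m+n} \<subseteq> {j. norm (P j v) < d}" for n k
        using small_block[OF inf_small d, of k n] unfolding P_def by blast
    qed
    moreover have "ereal c \<le> upper_density {j. norm (P j v) < d}"
      by (rule le_upper_density_if_frequent[OF small[OF d]])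
    moreover have "lower_density {j. norm (P j v) < d} < 1"
    proof (rule lower_density_less_one_if_frequent_Compl)
      show "frequent ((1 - c)/4) (- {j. norm (P j v) < d})"
        using large[of d] by (rule frequent_mono) auto
    qed (use b in simp)
    ultimately show ?thesis
      unfolding BF_lower_def BF_upper_def F_lower_def F_upper_def D by blast
  qed
  have "reiteratively_DC1 T"
    unfolding reiteratively_DC1_def
    by (intro exI[of _ L] conjI L exI[of _ 1] zero_less_one ballI impI exI[of _ c] c)
      (simp_all add: pair)
  moreover have "reiteratively_DC2 T"
    unfolding reiteratively_DC2_def
    by (intro exI[of _ L] conjI L exI[of _ 1] zero_less_one ballI impI) (simp_all add: pair)
  ultimately show ?thesis ..
qed

end
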